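(* Let $L>0$, $f\in\mathcal F_L(\mathbb R^n)$, $x_0\in\mathbb R^n$, and let $(x_k)_{k\in\mathbb N}$ be the trajectory of gradient descent $x_{k+1}:=x_k-\eta_k\nabla f(x_k)$ with initial point $x_0$ and step sizes satisfying $0<\eta_i\le 1/L$ for all $i$. Let $a_k:=\sum_{i=0}^{k-1}\eta_i$ and define $q_k:=-(x_k-x_0)/a_k$ for $k\ge1$. (a) $q_k\in\operatorname{dom} f^*$ for all $k\ge1$. (b) If the step sizes are chosen so that $a_k\to\infty$, then $q_k$ converges to the minimum-norm point of $\overline{\operatorname{dom} f^*}$. (c) If $\operatorname{dom} f^*$ has a minimum-norm point $p^\star$ and $\eta_i=1/L$ for all $i$, then for all $k\ge1$ $$\|q_k-p^\star\|^2\le\frac{8LD_f(x_0,p^\star)}{k},\qquad \|q_k\|^2-\|p^\star\|^2\le 2LD_f(x_0,p^\star)\,\frac{C_0+\log k}{k},$$ where $C_0:=1+\dfrac{\|\nabla f(x_0)\|^2-\|p^\star\|^2}{2LD_f(x_0,p^\star)}$ (with the convention $0/0:=0$ for the fraction).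
   Context: $\|\cdot\|$ and $\langle\cdot,\cdot\rangle$ are the Euclidean norm and inner product on $\mathbb R^n$. For $L>0$, $\mathcal F_L(\mathbb R^n)$ is the set of finite-valued differentiable convex functions $f:\mathbb R^n\to\mathbb R$ whose gradient is $L$-Lipschitz. The Legendre--Fenchel conjugate is $f^*(p):=\sup_{x\in\mathbb R^n}\{\langle p,x\rangle-f(x)\}\in\mathbb R\cup\{\infty\}$, and $\operatorname{dom} f^*:=\{p\in\mathbb R^n: f^*(p)<\infty\}$; it is a nonempty convex set, so its closure $\overline{\operatorname{dom} f^*}$ has a unique minimum-norm point. The dual divergence is $D_f(x,p):=f(x)+f^*(p)-\langle p,x\rangle$. *)

theory Defs
  imports "HOL-Analysis.Analysis"
begin

definition gradient :: "('a::euclidean_space \<Rightarrow> real) \<Rightarrow> 'a \<Rightarrow> 'a" where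
  "gradient f x = (THE g. GDERIV f x :> g)"

definition smooth_convex :: "real \<Rightarrow> ('a::euclidean_space \<Rightarrow> real) set" where
  "smooth_convex L = {f. (\<forall>x. f differentiable (at x)) \<and> convex_on UNIV f \<and>
                         L-lipschitz_on UNIV (gradient f)}"

definition conjugate :: "('a::euclidean_space \<Rightarrow> real) \<Rightarrow> 'a \<Rightarrow> ereal" where
  "conjugate f p = (SUP x. ereal (p \<bullet> x - f x))"

definition dom_conjugate :: "('a::euclidean_space \<Rightarrow> real) \<Rightarrow> 'a set" where
  "dom_conjugate f = {p. conjugate f p < \<infinity>}"

definition dual_divergence :: "('a::euclidean_space \<Rightarrow> real) \<Rightarrow> 'a \<Rightarrow> 'a \<Rightarrow> ereal" where
  "dual_divergence f x p = ereal (f x) + conjugate f p - ereal (p \<bullet> x)"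

definition is_min_norm_point :: "'a::euclidean_space set \<Rightarrow> 'a \<Rightarrow> bool" where
  "is_min_norm_point S p \<longleftrightarrow> is_arg_min norm (\<lambda>p. p \<in> S) p"

text \<open>The definite description in \<^const>\<open>gradient\<close> denotes at every point of differentiability.\<close>

lemma gderiv_gradient:
  assumes "f differentiable (at x)"
  shows "GDERIV f x :> gradient f x"
proof -
  obtain f' where f': "(f has_derivative f') (at x)"
    using assms by (auto simp: differentiable_def)
  interpret bounded_linear f' by (rule has_derivative_bounded_linear[OF f'])
  define g where "g = (\<Sum>b\<in>Basis. f' b *\<^sub>R b)"
  have fg: "f' h = h \<bullet> g" for h
  proof -
    have "f' h = f' (\<Sum>b\<in>Basis. (h \<bullet> b) *\<^sub>R b)" by (simp add: euclidean_representation)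
    also have "\<dots> = h \<bullet> g" by (simp add: sum scaleR g_def inner_sum_right mult.commute)
    finally show ?thesis .
  qed
  have "f' = (\<lambda>h. h \<bullet> g)" using fg by (rule ext)
  with f' have g: "GDERIV f x :> g" by (simp add: gderiv_def)
  have "g' = g" if "GDERIV f x :> g'" for g'
  proof -
    have "(\<lambda>h. h \<bullet> g') = (\<lambda>h. h \<bullet> g)"
      using that g unfolding gderiv_def by (rule has_derivative_unique)
    then have "h \<bullet> g' = h \<bullet> g" for h by (rule fun_cong)
    then show ?thesis by (metis inner_commute vector_eq_rdot)
  qed
  with g show ?thesis unfolding gradient_def by (rule theI)
qed

text \<open>On \<^const>\<open>dom_conjugate\<close> the dual divergence is finite, so there \<^const>\<open>real_of_ereal\<close>
  returns its value.\<close>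

lemma dual_divergence_finite:
  assumes "p \<in> dom_conjugate f"
  shows "ereal (real_of_ereal (dual_divergence f x p)) = dual_divergence f x p"
proof -
  have "ereal (p \<bullet> x - f x) \<le> conjugate f p"
    unfolding conjugate_def by (rule SUP_upper) simp
  then show ?thesis
    using assms by (cases "conjugate f p") (auto simp: dual_divergence_def dom_conjugate_def)
qed

end

theory Submission
  imports Defs
begin

text \<open>
  Write $g_i = \nabla f(x_i)$, so that $q_k$ is the $\eta$-weighted mean of $g_0,\dots,g_{k-1}$.
  Each $g_i$ lies in the convex set $\operatorname{dom} f^*$, which gives (a). Cocoercivity and
  $\eta_i \le 1/L$ yield the symmetric decrease
  $f(x_i) - f(x_{i+1}) \ge \frac{\eta_i}{2}(\|g_i\|^2 + \|g_{i+1}\|^2)$. Summing it and bounding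
  $f(x_k)$ from below by the Fenchel--Young inequality at $p \in \operatorname{dom} f^*$ gives
  \[ \sum_{i<k} \eta_i \bigl(\|g_i - p\|^2 + \|g_{i+1}\|^2 - \|p\|^2\bigr) \le 2 D_f(x_0, p). \]
  If $p^\star$ has minimum norm in the closure of $\operatorname{dom} f^*$, then
  $\|g_{i+1}\| \ge \|p^\star\|$, so Jensen's inequality yields
  $\|q_k - p\|^2 \le 2 D_f(x_0,p)/a_k + \|p\|^2 - \|p^\star\|^2$; letting first $k \to \infty$ and
  then $p \to p^\star$ proves (b). For $p = p^\star$, keeping either the first or the second group
  of terms proves the two bounds of (c), in fact with $2$ in place of $8$ and without the logarithm.
\<close>

section \<open>First-order inequalities for smooth convex functions\<close>

lemma smooth_convexD:
  assumes "f \<in> smooth_convex L"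
  shows "f differentiable (at x)" "convex_on UNIV f"
    and "norm (gradient f y - gradient f x) \<le> L * norm (y - x)"
proof -
  have lip: "L-lipschitz_on UNIV (gradient f)"
    using assms by (simp add: smooth_convex_def)
  show "f differentiable (at x)" "convex_on UNIV f"
    using assms by (simp_all add: smooth_convex_def)
  show "norm (gradient f y - gradient f x) \<le> L * norm (y - x)"
    using lipschitz_onD[OF lip, of y x] by (simp add: dist_norm)
qed

lemma has_real_derivative_along_line:
  fixes f :: "'a::euclidean_space \<Rightarrow> real"
  assumes "\<And>x. f differentiable (at x)"
  shows "((\<lambda>t. f (x + t *\<^sub>R h)) has_real_derivative h \<bullet> gradient f (x + t *\<^sub>R h)) (at t)"
proof -
  have f: "(f has_derivative (\<lambda>d. d \<bullet> gradient f (x + t *\<^sub>R h))) (at (x + t *\<^sub>R h))"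
    using gderiv_gradient[OF assms] by (simp add: gderiv_def)
  have l: "((\<lambda>t. x + t *\<^sub>R h) has_derivative (\<lambda>s. s *\<^sub>R h)) (at t)"
    by (auto intro!: derivative_eq_intros)
  have "(f \<circ> (\<lambda>t. x + t *\<^sub>R h) has_derivative
      (\<lambda>d. d \<bullet> gradient f (x + t *\<^sub>R h)) \<circ> (\<lambda>s. s *\<^sub>R h)) (at t)"
    by (rule diff_chain_at[OF l f])
  then show ?thesis
    by (simp add: has_field_derivative_def o_def mult.commute[of _ "h \<bullet> _"])
qed

text \<open>The restriction \<open>\<phi>\<close> of \<open>f\<close> to the line through
  \<open>x\<close> and \<open>y\<close> is convex in one real variable, hence lies above its tangent
  at 0, and the value at 1 is \<open>f y\<close>.\<close>

lemma convex_gradient_inequality: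
  fixes f :: "'a::euclidean_space \<Rightarrow> real"
  assumes "\<And>x. f differentiable (at x)" "convex_on UNIV f"
  shows "f y \<ge> f x + gradient f x \<bullet> (y - x)"
proof -
  define \<phi> where "\<phi> t = f (x + t *\<^sub>R (y - x))" for t
  have "convex_on UNIV \<phi>"
  proof (rule convex_onI)
    fix s u v :: real
    assume s: "0 < s" "s < 1"
    have "x + ((1 - s) *\<^sub>R u + s *\<^sub>R v) *\<^sub>R (y - x) =
        (1 - s) *\<^sub>R (x + u *\<^sub>R (y - x)) + s *\<^sub>R (x + v *\<^sub>R (y - x))"
      by (simp add: algebra_simps)
    then show "\<phi> ((1 - s) *\<^sub>R u + s *\<^sub>R v) \<le> (1 - s) * \<phi> u + s * \<phi> v"
      unfolding \<phi>_def using convex_onD[OF assms(2), of s] s by simp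
  qed simp
  moreover have "(\<phi> has_real_derivative (y - x) \<bullet> gradient f x) (at 0)"
    using has_real_derivative_along_line[OF assms(1), of x "y - x" 0] by (simp add: \<phi>_def [abs_def])
  ultimately have "\<phi> 1 - \<phi> 0 \<ge> (y - x) \<bullet> gradient f x * (1 - 0)"
    using convex_on_imp_above_tangent[of UNIV \<phi> 0 1] by auto
  then show ?thesis
    by (simp add: \<phi>_def inner_commute)
qed

lemma descent_lemma:
  fixes f :: "'a::euclidean_space \<Rightarrow> real"
  assumes "\<And>x. f differentiable (at x)"
    and lip: "\<And>x y. norm (gradient f y - gradient f x) \<le> L * norm (y - x)"
  shows "f y \<le> f x + gradient f x \<bullet> (y - x) + L / 2 * (norm (y - x))\<^sup>2"
proof -
  define h where "h = y - x"
  \<comment> \<open>\<open>\<phi>\<close> is \<open>f\<close> along the segment minus the linear and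
    quadratic terms of the claim, which thus becomes \<open>\<phi> 1 \<le> \<phi> 0\<close>; the
    Lipschitz bound makes the derivative nonpositive on [0,1].\<close>
  define \<phi> where "\<phi> t = f (x + t *\<^sub>R h) - t * (gradient f x \<bullet> h) - L / 2 * (norm h)\<^sup>2 * t\<^sup>2" for t
  have "\<phi> 1 \<le> \<phi> 0"
  proof (rule DERIV_nonpos_imp_nonincreasing[of 0 1 \<phi>])
    fix t :: real
    assume t: "0 \<le> t" "t \<le> 1"
    let ?d = "h \<bullet> gradient f (x + t *\<^sub>R h) - gradient f x \<bullet> h - L * (norm h)\<^sup>2 * t"
    have "(\<phi> has_real_derivative ?d) (at t)"
      unfolding \<phi>_def by (rule derivative_eq_intros has_real_derivative_along_line assms refl)+ simp
    moreover have "?d \<le> 0"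
    proof -
      have "(gradient f (x + t *\<^sub>R h) - gradient f x) \<bullet> h
          \<le> norm (gradient f (x + t *\<^sub>R h) - gradient f x) * norm h"
        by (rule norm_cauchy_schwarz)
      also have "\<dots> \<le> L * norm (t *\<^sub>R h) * norm h"
        using lip[of "x + t *\<^sub>R h" x] by (intro mult_right_mono) auto
      also have "\<dots> = L * (norm h)\<^sup>2 * t"
        using t by (simp add: power2_eq_square)
      finally show ?thesis
        by (simp add: inner_diff_right inner_commute)
    qed
    ultimately show "\<exists>d. (\<phi> has_real_derivative d) (at t) \<and> d \<le> 0" by blast
  qed simp
  then show ?thesis
    by (simp add: \<phi>_def h_def)
qed

text \<open>Subtracting the linear map with slope \<open>gradient f y\<close> from \<open>f\<close>
  gives a function minimized at \<open>y\<close>. Its gradient step of length 1/L from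
  \<open>x\<close> ends at \<open>z\<close>; the value at \<open>z\<close> is at least the minimum,
  while smoothness forces a decrease of \<open>(d \<bullet> d) / (2 * L)\<close>.\<close>

lemma smooth_convex_cocoercive:
  fixes f :: "'a::euclidean_space \<Rightarrow> real"
  assumes "L > 0" "f \<in> smooth_convex L"
  shows "f x \<ge> f y + gradient f y \<bullet> (x - y) + (norm (gradient f x - gradient f y))\<^sup>2 / (2 * L)"
proof -
  note f = smooth_convexD[OF assms(2)]
  define d where "d = gradient f x - gradient f y"
  define z where "z = x - d /\<^sub>R L"
  have "f z \<le> f x + gradient f x \<bullet> (z - x) + L / 2 * (norm (z - x))\<^sup>2"
    by (rule descent_lemma) (use f in auto)
  also have "L / 2 * (norm (z - x))\<^sup>2 = (d \<bullet> d) / (2 * L)"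
    using \<open>L > 0\<close> by (simp add: z_def power_mult_distrib power2_norm_eq_inner[symmetric] field_simps
        power2_eq_square)
  also have "gradient f x \<bullet> (z - x) = - (gradient f x \<bullet> d) / L"
    by (simp add: z_def field_simps)
  finally have up: "f z \<le> f x - (gradient f x \<bullet> d) / L + (d \<bullet> d) / (2 * L)" by simp
  have "f z \<ge> f y + gradient f y \<bullet> (z - y)"
    by (rule convex_gradient_inequality) (use f in auto)
  also have "gradient f y \<bullet> (z - y) = gradient f y \<bullet> (x - y) - (gradient f y \<bullet> d) / L"
    by (simp add: z_def inner_diff_right inner_add_right field_simps)
  finally have "f x \<ge> f y + gradient f y \<bullet> (x - y) + (gradient f x \<bullet> d - gradient f y \<bullet> d) / L
      - (d \<bullet> d) / (2 * L)"
    using up by (simp add: diff_divide_distrib)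
  also have "gradient f x \<bullet> d - gradient f y \<bullet> d = d \<bullet> d"
    by (simp add: d_def inner_diff_left)
  finally show ?thesis
    by (simp add: d_def power2_norm_eq_inner)
qed

text \<open>Cocoercivity contributes \<open>h \<bullet> (x - y) = \<eta> * (h \<bullet> g)\<close>,
  and since \<open>\<eta> \<le> 1 / L\<close> its quadratic term is at least \<eta>/2 times
  \<open>(norm (g - h))\<^sup>2\<close>, whose cross term cancels exactly this inner
  product.\<close>

lemma gradient_step_decrease:
  fixes f :: "'a::euclidean_space \<Rightarrow> real"
  assumes "L > 0" "f \<in> smooth_convex L" "0 < \<eta>" "\<eta> \<le> 1 / L"
    and y: "y = x - \<eta> *\<^sub>R gradient f x"
  shows "f x - f y \<ge> \<eta> / 2 * ((norm (gradient f x))\<^sup>2 + (norm (gradient f y))\<^sup>2)"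
proof -
  define g h where "g = gradient f x" and "h = gradient f y"
  have "f x \<ge> f y + h \<bullet> (x - y) + (norm (g - h))\<^sup>2 / (2 * L)"
    unfolding g_def h_def by (rule smooth_convex_cocoercive) fact+
  moreover have "h \<bullet> (x - y) = \<eta> * (h \<bullet> g)"
    by (simp add: y g_def)
  moreover have "\<eta> / 2 * (norm (g - h))\<^sup>2 \<le> (norm (g - h))\<^sup>2 / (2 * L)"
    using mult_right_mono[OF \<open>\<eta> \<le> 1 / L\<close>, of "(norm (g - h))\<^sup>2 / 2"] by (simp add: field_simps)
  moreover have "(norm (g - h))\<^sup>2 = (norm g)\<^sup>2 + (norm h)\<^sup>2 - 2 * (h \<bullet> g)"
    by (simp add: power2_norm_eq_inner inner_diff_left inner_diff_right inner_commute)
  ultimately show ?thesis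
    unfolding g_def[symmetric] h_def[symmetric] by (simp add: algebra_simps)
qed

section \<open>The domain of the conjugate\<close>

lemma dom_conjugate_iff: "p \<in> dom_conjugate f \<longleftrightarrow> (\<exists>c. \<forall>y. p \<bullet> y - f y \<le> c)"
proof
  assume "p \<in> dom_conjugate f"
  then obtain c where c: "conjugate f p \<le> ereal c"
    by (cases "conjugate f p") (auto simp: dom_conjugate_def)
  have "ereal (p \<bullet> y - f y) \<le> ereal c" for y
    by (rule order_trans[OF _ c]) (auto simp: conjugate_def intro: SUP_upper)
  then show "\<exists>c. \<forall>y. p \<bullet> y - f y \<le> c" by auto
next
  assume "\<exists>c. \<forall>y. p \<bullet> y - f y \<le> c"
  then obtain c where "\<forall>y. p \<bullet> y - f y \<le> c" by blast
  then have "conjugate f p \<le> ereal c"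
    unfolding conjugate_def by (intro SUP_least) simp
  then show "p \<in> dom_conjugate f"
    by (auto simp: dom_conjugate_def)
qed

lemma convex_dom_conjugate: "convex (dom_conjugate f)"
proof (rule convexI)
  fix p q :: 'a and u v :: real
  assume "p \<in> dom_conjugate f" "q \<in> dom_conjugate f" and uv: "0 \<le> u" "0 \<le> v" "u + v = 1"
  then obtain b c where bc: "\<And>y. p \<bullet> y - f y \<le> b" "\<And>y. q \<bullet> y - f y \<le> c"
    by (auto simp: dom_conjugate_iff)
  have "(u *\<^sub>R p + v *\<^sub>R q) \<bullet> y - f y \<le> u * b + v * c" for y
  proof -
    have "(u *\<^sub>R p + v *\<^sub>R q) \<bullet> y - f y = (u *\<^sub>R p + v *\<^sub>R q) \<bullet> y - (u + v) * f y"
      by (simp add: uv)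
    also have "\<dots> = u * (p \<bullet> y - f y) + v * (q \<bullet> y - f y)"
      by (simp add: algebra_simps inner_add_left)
    also have "\<dots> \<le> u * b + v * c"
      using bc uv by (intro add_mono mult_left_mono) auto
    finally show ?thesis .
  qed
  then show "u *\<^sub>R p + v *\<^sub>R q \<in> dom_conjugate f"
    by (auto simp: dom_conjugate_iff)
qed

text \<open>By the tangent inequality, the supremum defining the conjugate at
  \<open>gradient f x\<close> is attained at \<open>x\<close>.\<close>

lemma gradient_in_dom_conjugate:
  fixes f :: "'a::euclidean_space \<Rightarrow> real"
  assumes "\<And>x. f differentiable (at x)" "convex_on UNIV f"
  shows "gradient f x \<in> dom_conjugate f"
proof -
  have "gradient f x \<bullet> y - f y \<le> gradient f x \<bullet> x - f x" for y
    using convex_gradient_inequality[OF assms, of x y] by (simp add: inner_diff_right)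
  then show ?thesis
    by (auto simp: dom_conjugate_iff)
qed

text \<open>The supremum in the conjugate is at least its term at \<open>y\<close>. The resulting
  lower bound on \<open>f y\<close> stands in for a minimum of \<open>f\<close>, which need not
  exist.\<close>

lemma fenchel_young_dual_divergence:
  assumes "p \<in> dom_conjugate f"
  shows "f x - f y \<le> real_of_ereal (dual_divergence f x p) + p \<bullet> (x - y)"
proof -
  have "ereal (p \<bullet> y - f y) \<le> conjugate f p"
    unfolding conjugate_def by (rule SUP_upper) simp
  then show ?thesis
    using assms
    by (cases "conjugate f p") (auto simp: dual_divergence_def dom_conjugate_def inner_diff_right)
qed

section \<open>Weighted means and summed decrease along the trajectory\<close>

lemma weighted_mean_dist_square_le:
  fixes v :: "'i \<Rightarrow> 'a::real_inner"
  assumes "\<And>i. i \<in> A \<Longrightarrow> 0 \<le> w i" and m: "(\<Sum>i\<in>A. w i *\<^sub>R v i) = sum w A *\<^sub>R m"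
  shows "sum w A * (norm (m - p))\<^sup>2 \<le> (\<Sum>i\<in>A. w i * (norm (v i - p))\<^sup>2)"
proof -
  \<comment> \<open>Each square is expanded around \<open>m\<close>; the cross terms sum to zero
    because \<open>m\<close> is the weighted mean.\<close>
  have "(\<Sum>i\<in>A. w i * (norm (v i - p))\<^sup>2) =
      (\<Sum>i\<in>A. w i * (norm (v i - m))\<^sup>2 + 2 * ((w i *\<^sub>R v i - w i *\<^sub>R m) \<bullet> (m - p))
        + w i * (norm (m - p))\<^sup>2)"
    by (rule sum.cong)
      (simp_all add: power2_norm_eq_inner inner_diff_left inner_diff_right inner_commute algebra_simps)
  also have "\<dots> = (\<Sum>i\<in>A. w i * (norm (v i - m))\<^sup>2)
      + 2 * (((\<Sum>i\<in>A. w i *\<^sub>R v i) - sum w A *\<^sub>R m) \<bullet> (m - p)) + sum w A * (norm (m - p))\<^sup>2"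
    by (simp add: sum.distrib sum_subtractf sum_distrib_left sum_distrib_right inner_sum_left
        inner_diff_left scaleR_left.sum)
  also have "\<dots> \<ge> sum w A * (norm (m - p))\<^sup>2"
    using assms by (simp add: sum_nonneg)
  finally show ?thesis .
qed

lemma gradient_descent_telescope:
  fixes x :: "nat \<Rightarrow> 'a::real_normed_vector"
  assumes "\<And>k. x (Suc k) = x k - \<eta> k *\<^sub>R g k"
  shows "x 0 - x k = (\<Sum>i<k. \<eta> i *\<^sub>R g i)"
  by (induction k) (simp_all add: assms algebra_simps)

lemma gradient_descent_sum_bound:
  fixes f :: "'a::euclidean_space \<Rightarrow> real"
  assumes "L > 0" "f \<in> smooth_convex L"
    and x: "\<And>k. x (Suc k) = x k - \<eta> k *\<^sub>R gradient f (x k)"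
    and \<eta>: "\<And>i. 0 < \<eta> i \<and> \<eta> i \<le> 1 / L"
    and p: "p \<in> dom_conjugate f"
  shows "(\<Sum>i<k. \<eta> i * ((norm (gradient f (x i) - p))\<^sup>2 + (norm (gradient f (x (Suc i))))\<^sup>2
      - (norm p)\<^sup>2)) \<le> 2 * real_of_ereal (dual_divergence f (x 0) p)"
proof -
  define g where "g i = gradient f (x i)" for i
  have telescope: "(\<Sum>i<k. f (x i)) - (\<Sum>i<k. f (x (Suc i))) = f (x 0) - f (x k)"
    by (induction k) simp_all
  \<comment> \<open>The square of \<open>g i - p\<close> is expanded and the square of
    \<open>norm p\<close> cancels, leaving twice the guaranteed decrease and a term linear in
    \<open>p\<close>.\<close>
  have "(\<Sum>i<k. \<eta> i * ((norm (g i - p))\<^sup>2 + (norm (g (Suc i)))\<^sup>2 - (norm p)\<^sup>2))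
      = (\<Sum>i<k. 2 * (\<eta> i / 2 * ((norm (g i))\<^sup>2 + (norm (g (Suc i)))\<^sup>2)) - 2 * (p \<bullet> \<eta> i *\<^sub>R g i))"
    by (rule sum.cong)
      (simp_all add: power2_norm_eq_inner inner_diff_left inner_diff_right inner_commute algebra_simps)
  also have "\<dots> \<le> (\<Sum>i<k. 2 * (f (x i) - f (x (Suc i))) - 2 * (p \<bullet> \<eta> i *\<^sub>R g i))"
    unfolding g_def using gradient_step_decrease[OF assms(1,2) _ _ x] \<eta>
    by (intro sum_mono diff_right_mono mult_left_mono) auto
  also have "\<dots> = 2 * (f (x 0) - f (x k)) - 2 * (p \<bullet> (\<Sum>i<k. \<eta> i *\<^sub>R g i))"
    by (simp only: sum_subtractf inner_sum_right sum_distrib_left[symmetric]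
        telescope)
  also have "(\<Sum>i<k. \<eta> i *\<^sub>R g i) = x 0 - x k"
    unfolding g_def using gradient_descent_telescope[of x \<eta> "\<lambda>i. gradient f (x i)" k, OF x] by simp
  \<comment> \<open>Fenchel-Young removes \<open>x k\<close>, so the bound is uniform in
    \<open>k\<close>.\<close>
  also have "2 * (f (x 0) - f (x k)) - 2 * (p \<bullet> (x 0 - x k))
      \<le> 2 * real_of_ereal (dual_divergence f (x 0) p)"
    using fenchel_young_dual_divergence[OF p, of "x 0" "x k"] by simp
  finally show ?thesis
    unfolding g_def .
qed

section \<open>Minimum-norm points\<close>

lemma is_min_norm_point_iff:
  "is_min_norm_point S p \<longleftrightarrow> p \<in> S \<and> (\<forall>q\<in>S. norm p \<le> norm q)"
  by (auto simp: is_min_norm_point_def is_arg_min_def not_less)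

lemma ex1_min_norm_point:
  assumes "convex S" "closed S" "S \<noteq> {}"
  shows "\<exists>!p. is_min_norm_point S p"
proof (rule ex_ex1I)
  show "\<exists>p. is_min_norm_point S p"
    by (rule distance_attains_inf[OF assms(2,3), of 0]) (auto simp: is_min_norm_point_iff)
  show "p = q" if "is_min_norm_point S p" "is_min_norm_point S q" for p q
    using that any_closest_point_unique[OF assms(1,2), of p q 0]
    by (auto simp: is_min_norm_point_iff)
qed

lemma min_norm_point_closure_le:
  assumes "is_min_norm_point (closure S) p" "q \<in> S"
  shows "(norm p)\<^sup>2 \<le> (norm q)\<^sup>2"
  using assms closure_subset[of S] by (intro power_mono) (auto simp: is_min_norm_point_iff)

theorem theorem3p6:
  fixes L :: real and f :: "real ^ 'n \<Rightarrow> real" and x0 :: "real ^ 'n"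
    and x :: "nat \<Rightarrow> real ^ 'n" and \<eta> a :: "nat \<Rightarrow> real" and q :: "nat \<Rightarrow> real ^ 'n"
  assumes "L > 0"
    and "f \<in> smooth_convex L"
    and "x 0 = x0"
    and "\<And>k. x (Suc k) = x k - \<eta> k *\<^sub>R gradient f (x k)"
    and "\<And>i. 0 < \<eta> i \<and> \<eta> i \<le> 1 / L"
    and "\<And>k. a k = (\<Sum>i<k. \<eta> i)"
    and "\<And>k. k \<ge> 1 \<Longrightarrow> q k = - ((x k - x0) /\<^sub>R a k)"
  shows "(\<forall>k\<ge>1. q k \<in> dom_conjugate f)
    \<and> (filterlim a at_top sequentially \<longrightarrow>
        (\<exists>!p. is_min_norm_point (closure (dom_conjugate f)) p) \<and>
        (\<forall>p. is_min_norm_point (closure (dom_conjugate f)) p \<longrightarrow> q \<longlonglongrightarrow> p))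
    \<and> (\<forall>p. is_min_norm_point (dom_conjugate f) p \<and> (\<forall>i. \<eta> i = 1 / L) \<longrightarrow>
        (let D = real_of_ereal (dual_divergence f x0 p);
             C0 = 1 + ((norm (gradient f x0))\<^sup>2 - (norm p)\<^sup>2) / (2 * L * D)
         in \<forall>k\<ge>1. (norm (q k - p))\<^sup>2 \<le> 8 * L * D / real k
              \<and> (norm (q k))\<^sup>2 - (norm p)\<^sup>2 \<le> 2 * L * D * ((C0 + ln (real k)) / real k)))"
proof -
  note L = \<open>L > 0\<close> and f = \<open>f \<in> smooth_convex L\<close> and x0 = \<open>x 0 = x0\<close> and x = assms(4) and \<eta> = assms(5)
    and a = assms(6) and q = assms(7)
  define dom where "dom = dom_conjugate f"
  define g where "g i = gradient f (x i)" for i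
  define D where "D p = real_of_ereal (dual_divergence f x0 p)" for p
  have g_dom: "g i \<in> dom" for i
    unfolding g_def dom_def by (rule gradient_in_dom_conjugate) (rule smooth_convexD[OF f])+
  have a_pos: "a k > 0" if "k \<ge> 1" for k
    unfolding a using \<eta> that by (intro sum_pos) (auto simp: lessThan_empty_iff)
  have mean: "(\<Sum>i<k. \<eta> i *\<^sub>R g i) = a k *\<^sub>R q k" if "k \<ge> 1" for k
    using gradient_descent_telescope[of x \<eta> "\<lambda>i. gradient f (x i)" k, OF x] a_pos[OF that] x0
    by (simp add: q[OF that] g_def)
  have jensen: "a k * (norm (q k - p))\<^sup>2 \<le> (\<Sum>i<k. \<eta> i * (norm (g i - p))\<^sup>2)" if "k \<ge> 1" for k p
    unfolding a using weighted_mean_dist_square_le[of "{..<k}" \<eta> g "q k" p] mean[OF that] \<eta>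
    by (simp add: a less_imp_le)
  have bound: "(\<Sum>i<k. \<eta> i * (norm (g i - p))\<^sup>2) + (\<Sum>i<k. \<eta> i * ((norm (g (Suc i)))\<^sup>2 - (norm p)\<^sup>2))
      \<le> 2 * D p" if "p \<in> dom" for k p
    using gradient_descent_sum_bound[of L f x \<eta> p k, OF L f x \<eta> that[unfolded dom_def]]
    by (simp add: g_def D_def x0 sum.distrib[symmetric] algebra_simps)
  have part_a: "q k \<in> dom" if "k \<ge> 1" for k
  proof -
    have "(\<Sum>i<k. (\<eta> i / a k) *\<^sub>R g i) \<in> dom"
    proof (rule convex_sum)
      show "convex dom" unfolding dom_def by (rule convex_dom_conjugate)
      show "(\<Sum>i<k. \<eta> i / a k) = 1"
        using a_pos[OF that] by (simp add: sum_divide_distrib[symmetric] a[symmetric])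
      show "0 \<le> \<eta> i / a k" for i
        using a_pos[OF that] \<eta>[of i] by simp
    qed (use g_dom in auto)
    also have "(\<Sum>i<k. (\<eta> i / a k) *\<^sub>R g i) = (\<Sum>i<k. \<eta> i *\<^sub>R g i) /\<^sub>R a k"
      by (simp add: scaleR_sum_right field_simps)
    also have "\<dots> = q k"
      using mean[OF that] a_pos[OF that] by simp
    finally show ?thesis .
  qed
  have part_b: "q \<longlonglongrightarrow> p" if a_lim: "filterlim a at_top sequentially"
    and p: "is_min_norm_point (closure dom) p" for p
  proof (rule metric_LIMSEQ_I)
    fix e :: real
    assume e: "e > 0"
    have "p \<in> closure dom"
      using p by (simp add: is_min_norm_point_iff)
    \<comment> \<open>\<open>p\<close> may lie outside \<open>dom\<close>, where its dual divergence
      is infinite, so \<open>bound\<close> is applied to a nearby point \<open>s n\<close>, fixed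
      before \<open>k\<close> grows.\<close>
    then obtain s where s: "\<And>n. s n \<in> dom" "s \<longlonglongrightarrow> p"
      by (auto simp: closure_sequential)
    have "(\<lambda>n. (norm (s n))\<^sup>2 - (norm p)\<^sup>2) \<longlonglongrightarrow> (norm p)\<^sup>2 - (norm p)\<^sup>2"
      by (intro tendsto_intros s)
    \<comment> \<open>Half of \<open>(e / 2)\<^sup>2\<close> goes to this norm gap and half to
      \<open>2 * D (s n) / a k\<close>; together they put \<open>q k\<close> within
      \<open>e / 2\<close> of \<open>s n\<close>.\<close>
    then have "\<forall>\<^sub>F n in sequentially. (norm (s n))\<^sup>2 - (norm p)\<^sup>2 < (e / 2)\<^sup>2 / 2"
      by (rule order_tendstoD(2)) (use e in simp)
    moreover have "\<forall>\<^sub>F n in sequentially. dist (s n) p < e / 2"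
      using tendstoD[OF s(2), of "e / 2"] e by simp
    ultimately obtain n where n: "(norm (s n))\<^sup>2 - (norm p)\<^sup>2 < (e / 2)\<^sup>2 / 2" "dist (s n) p < e / 2"
      using eventually_happens[OF eventually_conj] by force
    have "(\<lambda>k. 2 * D (s n) / a k) \<longlonglongrightarrow> 0"
      by (rule real_tendsto_divide_at_top[OF tendsto_const a_lim])
    then have "\<forall>\<^sub>F k in sequentially. 2 * D (s n) / a k < (e / 2)\<^sup>2 / 2"
      by (rule order_tendstoD(2)) (use e in simp)
    then obtain N where N: "\<And>k. k \<ge> N \<Longrightarrow> 2 * D (s n) / a k < (e / 2)\<^sup>2 / 2"
      by (auto simp: eventually_sequentially)
    have "dist (q k) p < e" if k: "k \<ge> max 1 N" for k
    proof -
      \<comment> \<open>Every gradient lies in \<open>dom\<close>, so its norm is at least that of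
        \<open>p\<close>.\<close>
      have "a k * ((norm p)\<^sup>2 - (norm (s n))\<^sup>2)
          \<le> (\<Sum>i<k. \<eta> i * ((norm (g (Suc i)))\<^sup>2 - (norm (s n))\<^sup>2))"
        unfolding a sum_distrib_right using \<eta> min_norm_point_closure_le[OF p g_dom]
        by (intro sum_mono mult_left_mono) (auto intro: less_imp_le)
      then have "a k * (norm (q k - s n))\<^sup>2 \<le> 2 * D (s n) + a k * ((norm (s n))\<^sup>2 - (norm p)\<^sup>2)"
        using bound[OF s(1), of n k] jensen[of k "s n"] k by (simp add: algebra_simps)
      then have "(norm (q k - s n))\<^sup>2 \<le> 2 * D (s n) / a k + ((norm (s n))\<^sup>2 - (norm p)\<^sup>2)"
        using a_pos[of k] k by (simp add: field_simps)
      also have "\<dots> < (e / 2)\<^sup>2"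
        using N[of k] n(1) k by simp
      finally have "dist (q k) (s n) < e / 2"
        unfolding dist_norm by (rule power_less_imp_less_base) (use e in simp)
      then show ?thesis
        using n(2) dist_triangle[of "q k" p "s n"] by linarith
    qed
    then show "\<exists>N. \<forall>k\<ge>N. dist (q k) p < e" by blast
  qed
  have ex1: "\<exists>!p. is_min_norm_point (closure dom) p"
    using g_dom[of 0] closure_subset[of dom]
    by (intro ex1_min_norm_point convex_closure) (auto simp: dom_def convex_dom_conjugate)
  have part_c: "(norm (q k - p))\<^sup>2 \<le> 8 * L * D p / real k
      \<and> (norm (q k))\<^sup>2 - (norm p)\<^sup>2 \<le> 2 * L * D p *
        ((1 + ((norm (gradient f x0))\<^sup>2 - (norm p)\<^sup>2) / (2 * L * D p) + ln (real k)) / real k)"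
    if p: "is_min_norm_point dom p" and step: "\<And>i. \<eta> i = 1 / L" and k: "k \<ge> 1" for p k
  proof -
    have ak: "a k = real k / L"
      by (simp add: a step)
    have p_dom: "p \<in> dom" and p_le: "(norm p)\<^sup>2 \<le> (norm (g i))\<^sup>2" for i
      using p g_dom[of i] by (auto simp: is_min_norm_point_iff intro: power_mono)
    define T where "T = (\<Sum>i<k. (norm (g (Suc i)))\<^sup>2 - (norm p)\<^sup>2)"
    have T_nonneg: "T \<ge> 0"
      unfolding T_def using p_le by (simp add: sum_nonneg)
    have sum_bound: "(\<Sum>i<k. (norm (g i - p))\<^sup>2) + T \<le> 2 * L * D p"
      using bound[OF p_dom, of k] L
      by (simp add: step T_def sum_divide_distrib[symmetric] add_divide_distrib[symmetric] field_simps)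
    \<comment> \<open>Used with \<open>r = p\<close> for the distance bound and with
      \<open>r = 0\<close> for the norm bound.\<close>
    have jensen': "real k * (norm (q k - r))\<^sup>2 \<le> (\<Sum>i<k. (norm (g i - r))\<^sup>2)" for r
      using jensen[OF k, of r] L
      by (simp add: step ak sum_divide_distrib[symmetric] field_simps)
    have dist_bound: "real k * (norm (q k - p))\<^sup>2 \<le> 2 * L * D p"
      using jensen'[of p] sum_bound T_nonneg by linarith
    \<comment> \<open>This sign allows weakening the constant 2 to 8 and, below, adding the
      logarithmic term.\<close>
    have LD: "0 \<le> L * D p"
      using order_trans[OF _ dist_bound, of 0] by simp
    have "(norm (q k - p))\<^sup>2 \<le> 8 * L * D p / real k"
      using dist_bound LD k by (simp add: field_simps)
    moreover have "(norm (q k))\<^sup>2 - (norm p)\<^sup>2 \<le> 2 * L * D p *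
        ((1 + ((norm (g 0))\<^sup>2 - (norm p)\<^sup>2) / (2 * L * D p) + ln (real k)) / real k)"
    \<comment> \<open>Division by zero yields 0 in HOL, matching the convention 0/0 = 0; here
      \<open>q k = p\<close> and both sides vanish.\<close>
    proof (cases "D p = 0")
      case True
      then have "q k = p"
        using dist_bound k by (simp add: mult_le_0_iff)
      then show ?thesis
        using True by simp
    next
      case False
      have "real k * ((norm (q k))\<^sup>2 - (norm p)\<^sup>2) \<le> (\<Sum>i<k. (norm (g i))\<^sup>2 - (norm p)\<^sup>2)"
        using jensen'[of 0] by (simp add: sum_subtractf algebra_simps)
      \<comment> \<open>Adding the nonnegative term of index \<open>k\<close> and splitting off
        index 0 leaves the shifted sum \<open>T\<close>; the split-off term becomes the numerator in
        \<open>C0\<close>.\<close>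
      also have "\<dots> \<le> (\<Sum>i<Suc k. (norm (g i))\<^sup>2 - (norm p)\<^sup>2)"
        using p_le by simp
      also have "\<dots> = (norm (g 0))\<^sup>2 - (norm p)\<^sup>2 + T"
        unfolding T_def by (rule sum.lessThan_Suc_shift)
      also have "T \<le> 2 * L * D p"
        using sum_bound sum_nonneg[of "{..<k}" "\<lambda>i. (norm (g i - p))\<^sup>2"] by simp
      finally have "real k * ((norm (q k))\<^sup>2 - (norm p)\<^sup>2)
          \<le> (norm (g 0))\<^sup>2 - (norm p)\<^sup>2 + 2 * L * D p" by simp
      also have "\<dots> \<le> (norm (g 0))\<^sup>2 - (norm p)\<^sup>2 + 2 * L * D p + 2 * L * D p * ln (real k)"
        using LD k by (simp add: mult_nonneg_nonneg)
      also have "\<dots> = 2 * L * D p * (1 + ((norm (g 0))\<^sup>2 - (norm p)\<^sup>2) / (2 * L * D p) + ln (real k))"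
        using False L by (simp add: distrib_left)
      finally show ?thesis
        using k by (simp add: field_simps)
    qed
    ultimately show ?thesis
      by (simp add: g_def x0)
  qed
  show ?thesis
    using part_a part_b part_c ex1 unfolding dom_def D_def Let_def by blast
qed

end
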